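(* Let $k\geq 3$ be odd, and let $G_k$ be the graph with vertex set $\{u,w,v_0,v_1,\ldots,v_{3k-1}\}$ and edge set $\{v_0v_1,v_1v_2,\ldots,v_{3k-2}v_{3k-1},v_{3k-1}v_0\}\cup\{uv_i : i\equiv 1 \text{ or } 2 \pmod 3\}\cup\{wv_i : i\equiv 0 \text{ or } 1 \pmod 3\}$ (indices $i\in\{0,\ldots,3k-1\}$). Then $G_k$ is edge-critical: $G_k$ is uniquely 3-colorable and for every edge $e\in E(G_k)$, the graph $G_k-e$ is not uniquely 3-colorable.
   Context: A graph $G$ is uniquely $k$-colorable if its chromatic number is $k$ and $G$ has only one proper $k$-coloring up to permutation of the colors. A uniquely $k$-colorable graph $G$ is edge-critical if $G-e$ is not uniquely $k$-colorable for every edge $e\in E(G)$. *)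

theory Defs
  imports "HOL-Combinatorics.Permutations"
begin

text \<open>A graph is a pair of a vertex set and a set of edges, an edge being a two-element set of
  vertices.\<close>

type_synonym 'a graph = "'a set \<times> 'a set set"

definition simple_graph :: "'a graph \<Rightarrow> bool" where
  "simple_graph G \<longleftrightarrow> (\<forall>e \<in> snd G. \<exists>x y. x \<in> fst G \<and> y \<in> fst G \<and> x \<noteq> y \<and> e = {x, y})"

definition delete_edge :: "'a graph \<Rightarrow> 'a set \<Rightarrow> 'a graph" where
  "delete_edge G e = (fst G, snd G - {e})"

definition proper_coloring :: "'a graph \<Rightarrow> nat \<Rightarrow> ('a \<Rightarrow> nat) \<Rightarrow> bool" where
  "proper_coloring G k c \<longleftrightarrow>
    (\<forall>x \<in> fst G. c x < k) \<and> (\<forall>x y. {x, y} \<in> snd G \<longrightarrow> c x \<noteq> c y)"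

text \<open>Meaningful only if \<open>G\<close> has some finite proper coloring, e.g. for finite simple graphs.\<close>

definition chromatic_number :: "'a graph \<Rightarrow> nat" where
  "chromatic_number G = (LEAST k. \<exists>c. proper_coloring G k c)"

text \<open>Colorings are total functions, so they are compared on the vertices only.\<close>

definition uniquely_colorable :: "nat \<Rightarrow> 'a graph \<Rightarrow> bool" where
  "uniquely_colorable k G \<longleftrightarrow> chromatic_number G = k \<and>
    (\<exists>c. proper_coloring G k c \<and>
      (\<forall>c'. proper_coloring G k c' \<longrightarrow>
        (\<exists>p. p permutes {..<k} \<and> (\<forall>x \<in> fst G. c' x = p (c x)))))"

definition edge_critical :: "nat \<Rightarrow> 'a graph \<Rightarrow> bool" where
  "edge_critical k G \<longleftrightarrow> uniquely_colorable k G \<and>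
    (\<forall>e \<in> snd G. \<not> uniquely_colorable k (delete_edge G e))"

datatype vertex = U | W | V nat

definition G_graph :: "nat \<Rightarrow> vertex graph" where
  "G_graph k =
    ({U, W} \<union> {V i | i. i < 3 * k},
     {{V i, V ((i + 1) mod (3 * k))} | i. i < 3 * k}
     \<union> {{U, V i} | i. i < 3 * k \<and> (i mod 3 = 1 \<or> i mod 3 = 2)}
     \<union> {{W, V i} | i. i < 3 * k \<and> (i mod 3 = 0 \<or> i mod 3 = 1)})"

lemma finite_G_graph: "finite (fst (G_graph k))"
  by (simp add: G_graph_def)

lemma simple_graph_G_graph:
  assumes "k \<ge> 1"
  shows "simple_graph (G_graph k)"
proof -
  have "\<exists>x y. x \<in> fst (G_graph k) \<and> y \<in> fst (G_graph k) \<and> x \<noteq> y \<and>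
      {V i, V ((i + 1) mod (3 * k))} = {x, y}" if "i < 3 * k" for i
  proof (intro exI conjI)
    show "V i \<noteq> V ((i + 1) mod (3 * k))"
    proof (cases "i + 1 = 3 * k")
      case True
      moreover from this have "i > 0" using assms by linarith
      ultimately show ?thesis by simp
    qed (use that in simp)
  qed (use that in \<open>auto simp: G_graph_def\<close>)
  moreover have "\<exists>x y. x \<in> fst (G_graph k) \<and> y \<in> fst (G_graph k) \<and> x \<noteq> y \<and>
      {z, V i} = {x, y}" if "i < 3 * k" "z \<in> {U, W}" for i z
    by (rule exI[of _ z], rule exI[of _ "V i"]) (use that in \<open>auto simp: G_graph_def\<close>)
  ultimately show ?thesis
    unfolding simple_graph_def by (subst G_graph_def) auto
qed

end

theory Submission
  imports Defs
begin

text \<open>If \<open>u\<close> and \<open>w\<close> had the same color in a proper 3-coloring, the odd cycle would be 2-colored;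
  so their colors differ, which forces the color of every \<open>v\<^sub>i\<close> with \<open>i \<equiv> 1\<close>, and then of all other
  vertices. For criticality it suffices to find, for each edge \<open>e\<close>, a coloring whose only
  monochromatic edge is \<open>e\<close>. For a cycle edge, give \<open>u\<close> and \<open>w\<close> color 2 and alternate 0 and 1 on the
  cycle, starting after \<open>e\<close>. For an edge at \<open>v\<^sub>i\<close> with \<open>i \<equiv> 0\<close> or \<open>2\<close>, in addition recolor
  \<open>v\<^sub>i\<close> with 2. For an edge at \<open>v\<^sub>i\<close> with \<open>i \<equiv> 1\<close>, the 3-coloring of the whole graph can be
  repaired by exchanging the colors of \<open>v\<^sub>i\<close> and one of its neighbours on the cycle.\<close>

section \<open>Criterion for non-uniqueness, and properness edge by edge\<close>

lemma proper_coloring_delete_edge: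
  "proper_coloring G k c \<Longrightarrow> proper_coloring (delete_edge G e) k c"
  by (auto simp: proper_coloring_def delete_edge_def)

text \<open>Both \<open>c\<close> and \<open>d\<close> properly color the graph without the edge,
  but \<open>c\<close> separates its ends and \<open>d\<close> does not. Permuting colors preserves
  which vertices share a color, so the two cannot come from one coloring.\<close>

lemma not_uniquely_colorable_delete_edge:
  assumes "proper_coloring G k c" and "{x, y} \<in> snd G" and "x \<in> fst G" and "y \<in> fst G"
    and "proper_coloring (delete_edge G {x, y}) k d" and "d x = d y"
  shows "\<not> uniquely_colorable k (delete_edge G {x, y})"
proof
  assume "uniquely_colorable k (delete_edge G {x, y})"
  then obtain b where b: "\<And>c'. proper_coloring (delete_edge G {x, y}) k c' \<Longrightarrow>
      \<exists>p. p permutes {..<k} \<and> (\<forall>v \<in> fst G. c' v = p (b v))"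
    unfolding uniquely_colorable_def delete_edge_def by auto
  obtain p where p: "p permutes {..<k}" "\<forall>v \<in> fst G. d v = p (b v)"
    using b[OF assms(5)] by blast
  \<comment> \<open>Injectivity of \<open>p\<close> pulls the equality back from \<open>d\<close> to
    \<open>b\<close>; \<open>q\<close> then pushes it forward to \<open>c\<close>.\<close>
  have "b x = b y"
    using p assms(3,4,6) by (metis permutes_inj injD)
  moreover obtain q where "\<forall>v \<in> fst G. c v = q (b v)"
    using b[OF proper_coloring_delete_edge[OF assms(1)]] by blast
  ultimately have "c x = c y"
    using assms(3,4) by simp
  then show False
    using assms(1,2) by (auto simp: proper_coloring_def)
qed

lemma proper_coloring_delete_edge_G_graphI:
  assumes "c U < m" and "c W < m" and "\<And>i. i < 3 * k \<Longrightarrow> c (V i) < m"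
    and "\<And>i. i < 3 * k \<Longrightarrow> {V i, V ((i + 1) mod (3 * k))} \<noteq> e \<Longrightarrow> c (V i) \<noteq> c (V ((i + 1) mod (3 * k)))"
    and "\<And>i. i < 3 * k \<Longrightarrow> i mod 3 = 1 \<or> i mod 3 = 2 \<Longrightarrow> {U, V i} \<noteq> e \<Longrightarrow> c U \<noteq> c (V i)"
    and "\<And>i. i < 3 * k \<Longrightarrow> i mod 3 = 0 \<or> i mod 3 = 1 \<Longrightarrow> {W, V i} \<noteq> e \<Longrightarrow> c W \<noteq> c (V i)"
  shows "proper_coloring (delete_edge (G_graph k) e) m c"
  unfolding proper_coloring_def
proof (intro conjI ballI allI impI)
  show "c x < m" if "x \<in> fst (delete_edge (G_graph k) e)" for x
    using that assms(1-3) by (auto simp: delete_edge_def G_graph_def)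
next
  fix x y assume "{x, y} \<in> snd (delete_edge (G_graph k) e)"
  then obtain f where f: "f = {x, y}" "f \<in> snd (G_graph k)" "f \<noteq> e"
    by (simp add: delete_edge_def)
  from f(2) consider
      i where "i < 3 * k" "f = {V i, V ((i + 1) mod (3 * k))}"
    | i where "i < 3 * k" "i mod 3 = 1 \<or> i mod 3 = 2" "f = {U, V i}"
    | i where "i < 3 * k" "i mod 3 = 0 \<or> i mod 3 = 1" "f = {W, V i}"
    unfolding G_graph_def by auto
  then show "c x \<noteq> c y"
  proof cases
    case 1
    then show ?thesis using assms(4)[of i] f(1,3) by (metis doubleton_eq_iff)
  next
    case 2
    then show ?thesis using assms(5)[of i] f(1,3) by (metis doubleton_eq_iff)
  next
    case 3
    then show ?thesis using assms(6)[of i] f(1,3) by (metis doubleton_eq_iff)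
  qed
qed

text \<open>The wrap-around edge is split off so that the forcing arguments along the cycle need no
  arithmetic modulo \<open>3 * k\<close>.\<close>

lemma proper_coloring_G_graphD:
  assumes "proper_coloring (G_graph k) m c"
  shows "c U < m" and "c W < m" and "\<And>i. i < 3 * k \<Longrightarrow> c (V i) < m"
    and "\<And>i. i + 1 < 3 * k \<Longrightarrow> c (V i) \<noteq> c (V (i + 1))"
    and "k > 0 \<Longrightarrow> c (V (3 * k - 1)) \<noteq> c (V 0)"
    and "\<And>i. i < 3 * k \<Longrightarrow> i mod 3 \<noteq> 0 \<Longrightarrow> c U \<noteq> c (V i)"
    and "\<And>i. i < 3 * k \<Longrightarrow> i mod 3 \<noteq> 2 \<Longrightarrow> c W \<noteq> c (V i)"
proof -
  have edge: "c x \<noteq> c y" if "{x, y} \<in> snd (G_graph k)" for x y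
    using assms that by (auto simp: proper_coloring_def)
  show "c U < m" "c W < m" "\<And>i. i < 3 * k \<Longrightarrow> c (V i) < m"
    using assms by (auto simp: proper_coloring_def G_graph_def)
  have cyc: "c (V i) \<noteq> c (V ((i + 1) mod (3 * k)))" if "i < 3 * k" for i
    by (rule edge) (use that in \<open>auto simp: G_graph_def\<close>)
  show "c (V i) \<noteq> c (V (i + 1))" if "i + 1 < 3 * k" for i
    using cyc[of i] that by simp
  show "c (V (3 * k - 1)) \<noteq> c (V 0)" if "k > 0"
    using cyc[of "3 * k - 1"] that by simp
  show "c U \<noteq> c (V i)" if "i < 3 * k" "i mod 3 \<noteq> 0" for i
  proof (rule edge)
    have "i mod 3 = 1 \<or> i mod 3 = 2" using that(2) by linarith
    then show "{U, V i} \<in> snd (G_graph k)" using that(1) by (auto simp: G_graph_def)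
  qed
  show "c W \<noteq> c (V i)" if "i < 3 * k" "i mod 3 \<noteq> 2" for i
  proof (rule edge)
    have "i mod 3 = 0 \<or> i mod 3 = 1" using that(2) by linarith
    then show "{W, V i} \<in> snd (G_graph k)" using that(1) by (auto simp: G_graph_def)
  qed
qed

section \<open>The two basic colorings\<close>

fun block_coloring :: "vertex \<Rightarrow> nat" where
  "block_coloring U = 0"
| "block_coloring W = 1"
| "block_coloring (V i) = (if i mod 3 = 0 then 0 else if i mod 3 = 1 then 2 else 1)"

text \<open>For an odd cycle length, the only monochromatic cycle edge is the one from \<open>V j\<close> to its
  successor; this includes the wrap-around edge.\<close>

fun alternating_coloring :: "nat \<Rightarrow> vertex \<Rightarrow> nat" where
  "alternating_coloring j (V i) = (if i \<le> j then i mod 2 else (i + 1) mod 2)"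
| "alternating_coloring j _ = 2"

lemma Suc_mod_cases:
  fixes i n :: nat
  assumes "i < n"
  obtains "i + 1 < n" "(i + 1) mod n = i + 1" | "i + 1 = n" "(i + 1) mod n = 0"
  using assms by (cases "i + 1 = n") auto

lemma proper_coloring_block_coloring: "proper_coloring (G_graph k) 3 block_coloring"
proof -
  \<comment> \<open>The empty set is not an edge, so deleting it leaves the graph unchanged and the
    introduction rule covers the whole graph.\<close>
  have "proper_coloring (delete_edge (G_graph k) {}) 3 block_coloring"
  proof (rule proper_coloring_delete_edge_G_graphI)
    fix i assume "i < 3 * k"
    then show "block_coloring (V i) \<noteq> block_coloring (V ((i + 1) mod (3 * k)))"
    proof (cases rule: Suc_mod_cases)
      case 1
      moreover have "i mod 3 = 0 \<or> i mod 3 = 1 \<or> i mod 3 = 2" by linarith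
      ultimately show ?thesis by (auto simp: mod_Suc)
    next
      case 2
      have "i mod 3 = 2" using 2(1) by presburger
      then show ?thesis using 2(2) by simp
    qed
  qed auto
  moreover have "{} \<notin> snd (G_graph k)"
    by (auto simp: G_graph_def)
  ultimately show ?thesis
    by (simp add: delete_edge_def)
qed

text \<open>Parity alternates along the path except at \<open>j\<close>, where the shift by one
  repeats a color. At the wrap-around, \<open>V 0\<close> has color 0, while the last index is even
  and so has color 1 unless it equals \<open>j\<close>.\<close>

lemma alternating_coloring_cycle:
  assumes "odd k" and "i < 3 * k" and "j < 3 * k"
  shows "alternating_coloring j (V i) = alternating_coloring j (V ((i + 1) mod (3 * k))) \<longleftrightarrow> i = j"
  using assms(2)
proof (cases rule: Suc_mod_cases)
  case 1
  then show ?thesis by (auto simp: mod_Suc)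
next
  case 2
  have "even i" using 2(1) assms(1) by presburger
  then have "alternating_coloring j (V i) = 0 \<longleftrightarrow> i \<le> j"
    by (simp add: even_iff_mod_2_eq_zero mod_Suc)
  moreover have "i \<le> j \<longleftrightarrow> i = j" using 2(1) assms(3) by linarith
  ultimately show ?thesis unfolding 2(2) by simp
qed

section \<open>Unique 3-colorability\<close>

lemma third_color_unique:
  fixes a b x y :: nat
  assumes "a < 3" "b < 3" "x < 3" "y < 3" "a \<noteq> b" "a \<noteq> x" "b \<noteq> x" "a \<noteq> y" "b \<noteq> y"
  shows "x = y"
  using assms by (auto simp: numeral_3_eq_3 less_Suc_eq)

lemma coloring_U_neq_W:
  assumes c: "proper_coloring (G_graph k) 3 c" and "odd k"
  shows "c U \<noteq> c W"
proof
  assume eq: "c U = c W"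
  note D = proper_coloring_G_graphD[OF c]
  \<comment> \<open>Each cycle vertex is adjacent to \<open>U\<close> or \<open>W\<close>, so only
    two colors remain for the cycle.\<close>
  have avoid: "c U \<noteq> c (V i)" if "i < 3 * k" for i
    using D(6)[OF that] D(7)[OF that] eq by (cases "i mod 3 = 0") auto
  have alt: "c (V i) = c (V 0) \<longleftrightarrow> even i" if "i < 3 * k" for i
    using that
  proof (induction i)
    case (Suc i)
    then have IH: "c (V i) = c (V 0) \<longleftrightarrow> even i" by simp
    have step: "c (V i) \<noteq> c (V (Suc i))" using D(4)[of i] Suc.prems by simp
    show ?case
    proof (cases "even i")
      case False
      have "c (V (Suc i)) = c (V 0)"
        by (rule third_color_unique[of "c U" "c (V i)"])
          (use Suc.prems D(1) D(3)[of 0] D(3)[of i] D(3)[of "Suc i"] avoid[of 0] avoid[of i]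
            avoid[of "Suc i"] IH step False in simp_all)
      with False show ?thesis by simp
    qed (use IH step in auto)
  qed simp
  have "k > 0" using assms(2) by (cases k) auto
  \<comment> \<open>The last vertex thus repeats the color of its neighbour
    \<open>V 0\<close>.\<close>
  moreover have "even (3 * k - 1)" using assms(2) by presburger
  ultimately show False
    using alt[of "3 * k - 1"] D(5) by simp
qed

lemma coloring_eq_permuted_block_coloring:
  assumes c: "proper_coloring (G_graph k) 3 c" and "odd k"
  shows "\<exists>p. p permutes {..<3} \<and> (\<forall>x \<in> fst (G_graph k). c x = p (block_coloring x))"
proof -
  note D = proper_coloring_G_graphD[OF c]
  have k: "k > 0" using assms(2) by (cases k) auto
  have UW: "c U \<noteq> c W" by (rule coloring_U_neq_W) fact+
  \<comment> \<open>\<open>U\<close>, \<open>W\<close> and \<open>V 1\<close> represent the block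
    colors 0, 1 and 2; beyond these, \<open>permutes\<close> demands the identity.\<close>
  define p where
    "p x = (if x = 0 then c U else if x = 1 then c W else if x = 2 then c (V 1) else x)" for x :: nat
  have v1: "c (V 1) < 3" "c (V 1) \<noteq> c U" "c (V 1) \<noteq> c W"
    using D(3,6,7)[of 1] k by auto
  have "p permutes {..<3}"
  proof (rule inj_imp_permutes)
    show "inj_on p {..<3}"
      using UW v1 by (auto simp: inj_on_def p_def)
  qed (use D(1,2) v1 in \<open>auto simp: p_def\<close>)
  have mid: "c (V i) = c (V 1)" if "i < 3 * k" "i mod 3 = 1" for i
    by (rule third_color_unique[of "c U" "c W"])
      (use D(3)[OF that(1)] D(6)[OF that(1)] D(7)[OF that(1)] that(2) v1 UW D(1,2) in simp_all)
  have low: "c (V i) = c U" if "i < 3 * k" "i mod 3 = 0" for i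
  proof -
    \<comment> \<open>The successor, whose color is already known, is reached without wrapping
      around.\<close>
    have "i + 1 \<noteq> 3 * k" using that(2) by presburger
    then have i: "i + 1 < 3 * k" "(i + 1) mod 3 = 1" using that by (simp_all add: mod_Suc)
    show ?thesis
      by (rule third_color_unique[of "c W" "c (V 1)"])
        (use D(3)[OF that(1)] D(7)[OF that(1)] D(4)[OF i(1)] mid[OF i] that(2) v1 UW D(1,2)
          in simp_all)
  qed
  have high: "c (V i) = c W" if i: "i < 3 * k" "i mod 3 = 2" for i
  proof -
    obtain l where l: "i = l + 1" "l mod 3 = 1"
      using i(2) by (cases i) (auto simp: mod_Suc split: if_splits)
    have "c (V 1) \<noteq> c (V i)" using mid[of l] D(4)[of l] l i(1) by simp
    moreover have "c U \<noteq> c (V i)" using D(6)[OF i(1)] i(2) by simp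
    ultimately show ?thesis
      using third_color_unique[of "c U" "c (V 1)" "c (V i)" "c W"] D(1,2) D(3)[OF i(1)] v1 UW
      by metis
  qed
  have "c (V i) = p (block_coloring (V i))" if "i < 3 * k" for i
  proof -
    consider "i mod 3 = 0" | "i mod 3 = 1" | "i mod 3 = 2" by linarith
    then show ?thesis
      using low[OF that] mid[OF that] high[OF that] by cases (simp_all add: p_def)
  qed
  then have "\<forall>x \<in> fst (G_graph k). c x = p (block_coloring x)"
    by (auto simp: G_graph_def p_def simp del: block_coloring.simps(3))
  with \<open>p permutes {..<3}\<close> show ?thesis by blast
qed

lemma chromatic_number_G_graph:
  assumes "k > 0"
  shows "chromatic_number (G_graph k) = 3"
  unfolding chromatic_number_def
proof (rule Least_equality)
  show "\<exists>c. proper_coloring (G_graph k) 3 c"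
    using proper_coloring_block_coloring by blast
next
  fix m assume "\<exists>c. proper_coloring (G_graph k) m c"
  then obtain c where "proper_coloring (G_graph k) m c" ..
  note D = proper_coloring_G_graphD[OF this]
  \<comment> \<open>\<open>W\<close>, \<open>V 0\<close> and \<open>V 1\<close> form a triangle\<close>
  have "c W \<noteq> c (V 0)" "c W \<noteq> c (V 1)" "c (V 0) \<noteq> c (V 1)" "c W < m" "c (V 0) < m" "c (V 1) < m"
    using D(2) D(3,7)[of 0] D(3,7)[of 1] D(4)[of 0] assms by auto
  then show "3 \<le> m" by linarith
qed

lemma uniquely_colorable_G_graph:
  assumes "odd k"
  shows "uniquely_colorable 3 (G_graph k)"
  unfolding uniquely_colorable_def
  using assms chromatic_number_G_graph[of k] proper_coloring_block_coloring[of k]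
    coloring_eq_permuted_block_coloring[of k] odd_pos by blast

section \<open>Colorings after deleting an edge\<close>

lemma proper_coloring_alternating:
  assumes "odd k" and "j < 3 * k"
  shows "proper_coloring (delete_edge (G_graph k) {V j, V ((j + 1) mod (3 * k))}) 3
    (alternating_coloring j)"
proof (rule proper_coloring_delete_edge_G_graphI)
  fix i assume "i < 3 * k" "{V i, V ((i + 1) mod (3 * k))} \<noteq> {V j, V ((j + 1) mod (3 * k))}"
  then show "alternating_coloring j (V i) \<noteq> alternating_coloring j (V ((i + 1) mod (3 * k)))"
    using alternating_coloring_cycle[OF assms(1) _ assms(2)] by blast
qed auto

text \<open>Color 2 at \<open>V j\<close> removes the one monochromatic cycle edge, and clashes only
  along \<open>e\<close>: for these residues \<open>V j\<close> is adjacent to just one of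
  \<open>U\<close> and \<open>W\<close>.\<close>

lemma proper_coloring_alternating_upd:
  assumes "odd k" and "j < 3 * k" and e: "e = {U, V j} \<and> j mod 3 = 2 \<or> e = {W, V j} \<and> j mod 3 = 0"
  shows "proper_coloring (delete_edge (G_graph k) e) 3 ((alternating_coloring j)(V j := 2))"
proof (rule proper_coloring_delete_edge_G_graphI)
  fix i assume i: "i < 3 * k"
  have "(i + 1) mod (3 * k) \<noteq> i"
    using i
  proof (cases rule: Suc_mod_cases)
    case 2
    then have "i \<noteq> 0" by presburger
    with 2 show ?thesis by simp
  qed simp
  moreover have "alternating_coloring j (V l) \<noteq> 2" for l
    by auto
  ultimately show "((alternating_coloring j)(V j := 2)) (V i) \<noteq>
      ((alternating_coloring j)(V j := 2)) (V ((i + 1) mod (3 * k)))"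
    using alternating_coloring_cycle[OF assms(1) i assms(2)]
    by (metis fun_upd_apply vertex.inject)
qed (use e in auto)

text \<open>\<open>V (j - 1)\<close>, now of color 2, is not adjacent to \<open>U\<close>, and the
  outer cycle neighbours of the swapped pair both have color 1.\<close>

lemma proper_coloring_block_upd_U:
  assumes "j < 3 * k" and "j mod 3 = 1"
  shows "proper_coloring (delete_edge (G_graph k) {U, V j}) 3
    (block_coloring(V j := 0, V (j - 1) := 2))"
proof (rule proper_coloring_delete_edge_G_graphI)
  obtain l where l: "j = Suc l" "l mod 3 = 0"
    using assms(2) by (cases j) (auto simp: mod_Suc split: if_splits)
  fix i assume "i < 3 * k"
  then show "(block_coloring(V j := 0, V (j - 1) := 2)) (V i) \<noteq>
      (block_coloring(V j := 0, V (j - 1) := 2)) (V ((i + 1) mod (3 * k)))"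
  proof (cases rule: Suc_mod_cases)
    case 1
    moreover have "i mod 3 = 2" if "3 dvd Suc i" using that by presburger
    ultimately show ?thesis using l by (auto simp: mod_Suc)
  next
    case 2
    have "i mod 3 = 2" using 2(1) by presburger
    then show ?thesis using 2(2) l by (auto simp: mod_Suc)
  qed
qed (use assms in auto)

text \<open>Mirror image: \<open>V (j + 1)\<close> is not adjacent to \<open>W\<close>, and the
  outer cycle neighbours of the swapped pair both have color 0.\<close>

lemma proper_coloring_block_upd_W:
  assumes "j < 3 * k" and "j mod 3 = 1"
  shows "proper_coloring (delete_edge (G_graph k) {W, V j}) 3
    (block_coloring(V j := 1, V (j + 1) := 2))"
proof (rule proper_coloring_delete_edge_G_graphI)
  fix i assume "i < 3 * k"
  then show "(block_coloring(V j := 1, V (j + 1) := 2)) (V i) \<noteq>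
      (block_coloring(V j := 1, V (j + 1) := 2)) (V ((i + 1) mod (3 * k)))"
  proof (cases rule: Suc_mod_cases)
    case 1
    then show ?thesis using assms(2) by (auto simp: mod_Suc)
  next
    case 2
    have "i mod 3 = 2" using 2(1) by presburger
    then show ?thesis using 2 assms by auto
  qed
next
  fix i assume "i mod 3 = 0 \<or> i mod 3 = 1" "{W, V i} \<noteq> {W, V j}"
  then have "i \<noteq> j" "block_coloring (V i) \<noteq> 1" by auto
  moreover have "(j + 1) mod 3 = 2" using assms(2) by presburger
  with \<open>i mod 3 = 0 \<or> i mod 3 = 1\<close> have "i \<noteq> j + 1" by auto
  ultimately show "(block_coloring(V j := 1, V (j + 1) := 2)) W \<noteq>
      (block_coloring(V j := 1, V (j + 1) := 2)) (V i)"
    by simp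
qed (use assms in auto)

theorem theorem3p2:
  fixes k :: nat
  assumes "k \<ge> 3" and "odd k"
  shows "edge_critical 3 (G_graph k)"
  unfolding edge_critical_def
proof (intro conjI ballI)
  show "uniquely_colorable 3 (G_graph k)"
    by (rule uniquely_colorable_G_graph) fact
next
  fix e assume e: "e \<in> snd (G_graph k)"
  have critical: "\<not> uniquely_colorable 3 (delete_edge (G_graph k) e)"
    if "e = {x, y}" "x \<in> fst (G_graph k)" "y \<in> fst (G_graph k)"
      "proper_coloring (delete_edge (G_graph k) e) 3 d" "d x = d y" for x y d
    using not_uniquely_colorable_delete_edge[OF proper_coloring_block_coloring] e that by blast
  from e consider
      (cycle) j where "j < 3 * k" "e = {V j, V ((j + 1) mod (3 * k))}"
    | (U1) j where "j < 3 * k" "j mod 3 = 1" "e = {U, V j}"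
    | (U2) j where "j < 3 * k" "j mod 3 = 2" "e = {U, V j}"
    | (W0) j where "j < 3 * k" "j mod 3 = 0" "e = {W, V j}"
    | (W1) j where "j < 3 * k" "j mod 3 = 1" "e = {W, V j}"
    unfolding G_graph_def by auto
  then show "\<not> uniquely_colorable 3 (delete_edge (G_graph k) e)"
  proof cases
    case cycle
    show ?thesis
    proof (rule critical)
      show "proper_coloring (delete_edge (G_graph k) e) 3 (alternating_coloring j)"
        using proper_coloring_alternating cycle assms(2) by blast
      show "alternating_coloring j (V j) = alternating_coloring j (V ((j + 1) mod (3 * k)))"
        using alternating_coloring_cycle cycle(1) assms(2) by blast
    qed (use cycle in \<open>auto simp: G_graph_def\<close>)
  next
    case U1
    show ?thesis
      by (rule critical[OF U1(3) _ _ proper_coloring_block_upd_U[OF U1(1,2), folded U1(3)]])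
        (use U1 in \<open>auto simp: G_graph_def\<close>)
  next
    case U2
    show ?thesis
      by (rule critical[OF U2(3) _ _ proper_coloring_alternating_upd[OF assms(2) U2(1)]])
        (use U2 in \<open>auto simp: G_graph_def\<close>)
  next
    case W0
    show ?thesis
      by (rule critical[OF W0(3) _ _ proper_coloring_alternating_upd[OF assms(2) W0(1)]])
        (use W0 in \<open>auto simp: G_graph_def\<close>)
  next
    case W1
    show ?thesis
      by (rule critical[OF W1(3) _ _ proper_coloring_block_upd_W[OF W1(1,2), folded W1(3)]])
        (use W1 in \<open>auto simp: G_graph_def\<close>)
  qed
qed

end
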